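(* Assume that the Collatz map $T$ has no divergent trajectories, i.e. there is no $n\in\mathbb{N}^*$ with $T^k(n)\to\infty$ as $k\to\infty$. Then the operator $\mathcal{L}\colon\ell_1\to\ell_1$ given by $$\mathcal{L}(x)=\lim_{k\to\infty}\frac{x-L_{T,1}(x)+\cdots+(-1)^{k-1}L_{T,1}^{k-1}(x)}{k}\qquad(\text{limit in the norm of }\ell_1)$$ is well-defined and bounded with norm $1$. Furthermore, for every $x=(x_n)_{n=1}^\infty\in\ell_1$, $$\mathcal{L}(x)=\sum_{i:\ l(\mathcal{C}_i)\text{ even}}\frac{\sum_{n\in N_i}(-1)^{s(n)}x_n}{l(\mathcal{C}_i)}\sum_{j=1}^{l(\mathcal{C}_i)}(-1)^{j-1}e_{n_{ji}}.$$
   Context: $\mathbb{N}^*=\{1,2,3,\dots\}$. The Collatz map $T\colon\mathbb{N}^*\to\mathbb{N}^*$ is $T(n)=n/2$ for $n$ even and $T(n)=(3n+1)/2$ for $n$ odd. $\ell_1$ has unit vectors $(e_n)_{n\in\mathbb{N}^*}$, and $L_{T,1}\colon\ell_1\to\ell_1$ is the bounded linear operator $L_{T,1}\left(\sum_n x_ne_n\right)=\sum_n x_ne_{T(n)}$. A cycle is a finite set $\mathcal{C}=\{n_1,\dots,n_k\}\subset\mathbb{N}^*$ of $k$ distinct elements with $T(n_i)=n_{i+1}$ for $i<k$ and $T(n_k)=n_1$; its length is $l(\mathcal{C})=k$. The (at most countably many, pairwise disjoint) cycles are enumerated as $\mathcal{C}_1,\mathcal{C}_2,\dots$. For each $i$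 fix an enumeration $\mathcal{C}_i=\{n_{ji}\mid j=1,\dots,l(\mathcal{C}_i)\}$ with $T(n_{ji})=n_{j+1,i}$ for $j<l(\mathcal{C}_i)$ and $T(n_{l(\mathcal{C}_i)i})=n_{1i}$. $N_i$ is the set of $n\in\mathbb{N}^*$ whose trajectory $(T^k(n))_{k\ge0}$ enters $\mathcal{C}_i$, and for $n\in N_i$, $s(n)$ is the least integer $s\ge0$ with $T^s(n)=n_{1i}$. *)

theory Defs
  imports "HOL-Analysis.Analysis"
begin

section \<open>The Collatz map\<close>

text \<open>The positive integers are the set \<open>{1..}\<close> of naturals. It is invariant under the
  map below; the value at \<open>0\<close> (which is \<open>0\<close>) is irrelevant.\<close>

definition collatz :: "nat \<Rightarrow> nat" where
  "collatz n = (if even n then n div 2 else (3 * n + 1) div 2)"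

definition divergent_trajectory :: "nat \<Rightarrow> bool" where
  "divergent_trajectory n \<longleftrightarrow> filterlim (\<lambda>k. (collatz ^^ k) n) at_top sequentially"

definition cycle_enumeration :: "nat set \<Rightarrow> (nat \<Rightarrow> nat) \<Rightarrow> nat \<Rightarrow> bool" where
  "cycle_enumeration C c k \<longleftrightarrow>
     k \<ge> 1 \<and> bij_betw c {1..k} C \<and>
     (\<forall>j\<in>{1..<k}. collatz (c j) = c (j + 1)) \<and> collatz (c k) = c 1"

text \<open>The length \<open>k\<close> of an enumeration is forced to be \<open>card C\<close>, so the length of a
  cycle \<open>C\<close> is \<open>card C\<close>.\<close>

definition is_cycle :: "nat set \<Rightarrow> bool" where
  "is_cycle C \<longleftrightarrow> C \<subseteq> {1..} \<and> (\<exists>c k. cycle_enumeration C c k)"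

definition basin :: "nat set \<Rightarrow> nat set" where
  "basin C = {n \<in> {1..}. \<exists>k. (collatz ^^ k) n \<in> C}"

definition hitting_time :: "nat \<Rightarrow> nat \<Rightarrow> nat" where
  "hitting_time m n = (LEAST s. (collatz ^^ s) n = m)"


section \<open>The Banach space of absolutely summable sequences\<close>

text \<open>Sequences are indexed by the positive integers, so the unused coordinate \<open>0\<close> is
  required to vanish. The scalars are kept generic; \<open>real\<close> and \<open>complex\<close> are the
  intended instances.\<close>

typedef (overloaded) 'a l1 =
    "{x :: nat \<Rightarrow> 'a::real_normed_field. x 0 = 0 \<and> summable (\<lambda>n. norm (x n))}"
  morphisms l1_nth Abs_l1
  by (rule exI[of _ "\<lambda>_. 0"]) auto

setup_lifting type_definition_l1

lemma l1_nth_0 [simp]: "l1_nth x 0 = 0"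
  using l1_nth[of x] by simp

lemma summable_norm_l1_nth: "summable (\<lambda>n. norm (l1_nth x n))"
  using l1_nth[of x] by simp

lemma l1_eqI: "(\<And>n. l1_nth x n = l1_nth y n) \<Longrightarrow> x = y"
  by (metis ext l1_nth_inject)

lemma summable_norm_add:
  fixes x y :: "nat \<Rightarrow> 'a::real_normed_vector"
  assumes "summable (\<lambda>n. norm (x n))" "summable (\<lambda>n. norm (y n))"
  shows "summable (\<lambda>n. norm (x n + y n))"
  by (rule summable_comparison_test'[OF summable_add[OF assms], of 0])
     (simp add: norm_triangle_ineq)

instantiation l1 :: (real_normed_field) real_normed_vector
begin

lift_definition zero_l1 :: "'a l1" is "\<lambda>_. 0" by simp

lift_definition plus_l1 :: "'a l1 \<Rightarrow> 'a l1 \<Rightarrow> 'a l1" is "\<lambda>x y n. x n + y n"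
  by (simp add: summable_norm_add)

lift_definition uminus_l1 :: "'a l1 \<Rightarrow> 'a l1" is "\<lambda>x n. - x n"
  by simp

definition minus_l1 :: "'a l1 \<Rightarrow> 'a l1 \<Rightarrow> 'a l1" where
  "minus_l1 x y = x + - y"

lift_definition scaleR_l1 :: "real \<Rightarrow> 'a l1 \<Rightarrow> 'a l1" is "\<lambda>r x n. r *\<^sub>R x n"
  by (simp add: summable_mult)

definition norm_l1 :: "'a l1 \<Rightarrow> real" where
  "norm_l1 x = (\<Sum>n. norm (l1_nth x n))"

definition dist_l1 :: "'a l1 \<Rightarrow> 'a l1 \<Rightarrow> real" where
  "dist_l1 x y = norm (x - y)"

definition sgn_l1 :: "'a l1 \<Rightarrow> 'a l1" where
  "sgn_l1 x = inverse (norm x) *\<^sub>R x"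

definition uniformity_l1 :: "('a l1 \<times> 'a l1) filter" where
  "uniformity_l1 = (INF e\<in>{0<..}. principal {(x, y). dist x y < e})"

definition open_l1 :: "'a l1 set \<Rightarrow> bool" where
  "open_l1 U \<longleftrightarrow> (\<forall>x\<in>U. \<forall>\<^sub>F (x', y) in uniformity. x' = x \<longrightarrow> y \<in> U)"

instance
proof
  fix x y z :: "'a l1" and a b :: real
  note nth = zero_l1.rep_eq plus_l1.rep_eq uminus_l1.rep_eq scaleR_l1.rep_eq
  show "x + y + z = x + (y + z)" by (rule l1_eqI) (simp add: nth add.assoc)
  show "x + y = y + x" by (rule l1_eqI) (simp add: nth add.commute)
  show "0 + x = x" by (rule l1_eqI) (simp add: nth)
  show "- x + x = 0" by (rule l1_eqI) (simp add: nth)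
  show "x - y = x + - y" by (rule minus_l1_def)
  show "a *\<^sub>R (x + y) = a *\<^sub>R x + a *\<^sub>R y"
    by (rule l1_eqI) (simp add: nth scaleR_right_distrib)
  show "(a + b) *\<^sub>R x = a *\<^sub>R x + b *\<^sub>R x"
    by (rule l1_eqI) (simp add: nth scaleR_left_distrib)
  show "a *\<^sub>R b *\<^sub>R x = (a * b) *\<^sub>R x" by (rule l1_eqI) (simp add: nth)
  show "1 *\<^sub>R x = x" by (rule l1_eqI) (simp add: nth)
  show "dist x y = norm (x - y)" by (rule dist_l1_def)
  show "sgn x = inverse (norm x) *\<^sub>R x" by (rule sgn_l1_def)
  show "uniformity = (INF e\<in>{0<..}. principal {(x :: 'a l1, y). dist x y < e})"
    by (rule uniformity_l1_def)
  show "open U \<longleftrightarrow> (\<forall>x\<in>U. \<forall>\<^sub>F (x', y) in uniformity. x' = x \<longrightarrow> y \<in> U)"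
    for U :: "'a l1 set" by (rule open_l1_def)
  show "norm x = 0 \<longleftrightarrow> x = 0"
  proof
    assume "norm x = 0"
    then have "\<forall>n. norm (l1_nth x n) = 0"
      using suminf_eq_zero_iff[OF summable_norm_l1_nth, of x] by (simp add: norm_l1_def)
    then show "x = 0" by (intro l1_eqI) (simp add: nth)
  qed (simp add: norm_l1_def nth)
  show "norm (x + y) \<le> norm x + norm y"
    unfolding norm_l1_def nth
    by (subst suminf_add[OF summable_norm_l1_nth summable_norm_l1_nth],
        intro suminf_le summable_add summable_norm_add summable_norm_l1_nth)
       (rule norm_triangle_ineq)
  show "norm (a *\<^sub>R x) = \<bar>a\<bar> * norm x"
    unfolding norm_l1_def nth by (simp add: suminf_mult summable_norm_l1_nth)
qed

end

text \<open>Multiplication by elements of the scalar field (the class instance above only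
  provides multiplication by reals).\<close>

lift_definition l1_scale :: "'a::real_normed_field \<Rightarrow> 'a l1 \<Rightarrow> 'a l1"  (infixr "*\<^sub>l" 75)
  is "\<lambda>c x n. c * x n"
  by (simp add: norm_mult summable_mult)

text \<open>The unit vector \<open>e\<^sub>n\<close>, meaningful for \<open>n \<ge> 1\<close> only; the index \<open>0\<close> gives
  the zero vector.\<close>

lift_definition l1_unit :: "nat \<Rightarrow> 'a::real_normed_field l1"
  is "\<lambda>n m. if m = n \<and> n \<noteq> 0 then 1 else 0"
proof -
  fix n :: nat
  have "summable (\<lambda>m. norm (if m = n \<and> n \<noteq> 0 then 1 else 0 :: 'a))"
    by (rule summable_finite[of "{n}"]) auto
  then show "(if 0 = n \<and> n \<noteq> 0 then 1 else 0 :: 'a) = 0 \<and>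
      summable (\<lambda>m. norm (if m = n \<and> n \<noteq> 0 then 1 else 0 :: 'a))"
    by auto
qed


section \<open>The operators\<close>

definition collatz_op :: "'a::{real_normed_field,banach} l1 \<Rightarrow> 'a l1" where
  "collatz_op x = (\<Sum>\<^sub>\<infinity>n\<in>{1..}. l1_nth x n *\<^sub>l l1_unit (collatz n))"

definition alternating_mean :: "nat \<Rightarrow> 'a::{real_normed_field,banach} l1 \<Rightarrow> 'a l1" where
  "alternating_mean k x =
     (1 / real k) *\<^sub>R (\<Sum>j<k. (-1) ^ j *\<^sub>R (collatz_op ^^ j) x)"

definition limit_op :: "'a::{real_normed_field,banach} l1 \<Rightarrow> 'a l1" where
  "limit_op x = lim (\<lambda>k. alternating_mean k x)"

end

theory Submission
  imports Defs "HOL-Combinatorics.Orbits"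
begin

text \<open>The operator sends \<open>e\<^sub>n\<close> to \<open>e\<close> indexed by the successor of \<open>n\<close>, so on a unit vector the
  alternating mean is the arithmetic mean of the sequence \<open>(-1)\<^sup>j e\<close> indexed by the \<open>j\<close>-th iterate
  of \<open>n\<close>. A trajectory that does not diverge returns infinitely often below some bound, hence
  repeats a value and runs into a cycle (\<open>not_divergent_imp_basin\<close>). From then on a passage
  through a cycle of length \<open>k\<close> reproduces the signed sequence up to the factor \<open>(-1)\<^sup>k\<close>. The
  arithmetic means of an eventually periodic sequence converge to its mean over one period
  (\<open>Cesaro_mean_eventually_periodic\<close>). For even \<open>k\<close> this is the alternating mean of the unit
  vectors of the cycle, with a sign that records when the trajectory reaches the starting point of
  the cycle; for odd \<open>k\<close> the signed sequence has period \<open>2 * k\<close> and its two halves cancel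
  (\<open>alternating_mean_l1_unit_tendsto\<close>).

  Everything else is linear extension. The space \<open>\<ell>\<^sub>1\<close> is complete, so a bounded choice of images of
  the unit vectors extends to a bounded linear operator, here called \<open>l1_extension\<close>, and every
  bounded linear operator is of this form (\<open>linear_eq_l1_extension\<close>). The alternating means have
  norm at most 1, so their convergence on unit vectors implies convergence at every point, by
  dominated convergence for series (\<open>l1_extension_tendsto\<close>). The limit is the extension of the
  limits on unit vectors, which also have norm at most 1. Norm 1 is attained at \<open>e\<^sub>1 - e\<^sub>2\<close>: the
  Collatz operator negates this vector because 1 and 2 form a cycle, so all alternating means fix
  it. Finally, the basins of the cycles partition the positive integers, and the formula for the
  limit is the absolutely convergent expansion over all unit vectors, regrouped by basins.\<close>

section \<open>The Banach space of absolutely summable sequences\<close>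

lemmas l1_nth_simps = zero_l1.rep_eq plus_l1.rep_eq uminus_l1.rep_eq scaleR_l1.rep_eq
  l1_scale.rep_eq l1_unit.rep_eq

lemma l1_nth_diff: "l1_nth (x - y) n = l1_nth x n - l1_nth y n"
  by (simp only: minus_l1_def l1_nth_simps) simp

lemma has_sum_atLeast_1:
  fixes f :: "nat \<Rightarrow> real"
  assumes "summable f" "\<And>n. f n \<ge> 0" "f 0 = 0"
  shows "(f has_sum suminf f) {1..}"
proof -
  have "(f has_sum suminf f) {1..} \<longleftrightarrow> (f has_sum suminf f) UNIV"
    using assms(3) by (intro has_sum_cong_neutral) (auto simp: not_le)
  with assms show ?thesis
    by (simp add: sums_nonneg_imp_has_sum summable_sums)
qed

text \<open>Sums over the positive integers, rather than over all naturals, match the definition of the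
  Collatz operator; the coordinate \<open>0\<close> contributes nothing to the norm.\<close>

lemma norm_l1_has_sum: "((\<lambda>n. norm (l1_nth x n)) has_sum norm x) {1..}"
  unfolding norm_l1_def by (intro has_sum_atLeast_1 summable_norm_l1_nth) auto

lemma sum_norm_l1_nth_le: "(\<Sum>n<N. norm (l1_nth x n)) \<le> norm x"
  unfolding norm_l1_def by (intro sum_le_suminf summable_norm_l1_nth) auto

lemma norm_l1_nth_le: "norm (l1_nth x n) \<le> norm x"
  using member_le_sum[of n "{..<Suc n}" "\<lambda>n. norm (l1_nth x n)"] sum_norm_l1_nth_le[of x "Suc n"]
  by auto

lemma norm_l1_leI:
  assumes "\<And>N. (\<Sum>n<N. norm (l1_nth x n)) \<le> B"
  shows "norm x \<le> B"
  unfolding norm_l1_def by (intro suminf_le_const summable_norm_l1_nth assms)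

lemma bounded_linear_l1_nth: "bounded_linear (\<lambda>x :: 'a::real_normed_field l1. l1_nth x n)"
  by (rule bounded_linear_intro[where K = 1]) (auto simp: l1_nth_simps norm_l1_nth_le)

lemma norm_l1_scale [simp]: "norm (c *\<^sub>l x) = norm c * norm x"
  by (simp add: norm_l1_def l1_nth_simps norm_mult suminf_mult summable_norm_l1_nth)

lemma norm_l1_unit_le: "norm (l1_unit n :: 'a::real_normed_field l1) \<le> 1"
proof -
  have "(\<lambda>m. norm (l1_nth (l1_unit n :: 'a l1) m)) =
      (\<lambda>m. if m = n then (if n = 0 then 0 else 1) else 0)"
    by (auto simp: l1_nth_simps)
  with sums_single[of n "\<lambda>_. if n = 0 then 0 else 1 :: real"] show ?thesis
    by (simp add: norm_l1_def sums_iff)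
qed

lemma vector_space_l1: "vector_space ((*\<^sub>l) :: 'a::real_normed_field \<Rightarrow> 'a l1 \<Rightarrow> 'a l1)"
  by unfold_locales (auto intro!: l1_eqI simp: l1_nth_simps algebra_simps)

interpretation l1: vector_space "(*\<^sub>l) :: 'a::real_normed_field \<Rightarrow> 'a l1 \<Rightarrow> 'a l1"
  by (rule vector_space_l1)

lemma l1_scale_of_real: "of_real r *\<^sub>l x = r *\<^sub>R x"
  by (rule l1_eqI) (simp add: l1_nth_simps scaleR_conv_of_real)

lemma l1_scale_neg_one_power: "(-1) ^ j *\<^sub>l x = (-1) ^ j *\<^sub>R x"
  using l1_scale_of_real[of "(-1) ^ j" x] by simp

lemma bounded_linear_l1_scale_left: "bounded_linear (\<lambda>c. c *\<^sub>l x)"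
  by (rule bounded_linear_intro[where K = "norm x"])
     (auto intro!: l1_eqI simp: l1_nth_simps algebra_simps)

lemma bounded_linear_l1_scale_right: "bounded_linear (\<lambda>x. c *\<^sub>l x)"
  by (rule bounded_linear_intro[where K = "norm c"])
     (auto intro!: l1_eqI simp: l1_nth_simps algebra_simps)

lemma l1_scale_scaleR: "c *\<^sub>l r *\<^sub>R x = r *\<^sub>R c *\<^sub>l x"
  by (rule l1_eqI) (simp add: l1_nth_simps)

text \<open>A Cauchy sequence converges in every coordinate. The coordinatewise limit is summable and is
  also the limit in norm because every partial sum of the norm depends on finitely many
  coordinates only: an eventual bound on the norms of the differences passes to the partial sums
  of the limit, uniformly in their length.\<close>

instance l1 :: ("{real_normed_field, banach}") banach
proof
  fix X :: "nat \<Rightarrow> 'a l1"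
  assume X: "Cauchy X"
  have "Cauchy (\<lambda>k. l1_nth (X k) n)" for n
    by (rule bounded_linear.Cauchy[OF bounded_linear_l1_nth X])
  then have "\<exists>y. \<forall>n. (\<lambda>k. l1_nth (X k) n) \<longlonglongrightarrow> y n"
    by (intro choice allI) (auto simp: Cauchy_convergent_iff convergent_def)
  then obtain y where y: "\<And>n. (\<lambda>k. l1_nth (X k) n) \<longlonglongrightarrow> y n"
    by blast
  have y_diff: "(\<Sum>n<N. norm (l1_nth z n - y n)) \<le> e"
    if "\<forall>\<^sub>F k in sequentially. norm (z - X k) \<le> e" for z :: "'a l1" and N e
  proof (rule tendsto_upperbound)
    show "(\<lambda>k. \<Sum>n<N. norm (l1_nth (z - X k) n)) \<longlonglongrightarrow> (\<Sum>n<N. norm (l1_nth z n - y n))"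
      unfolding l1_nth_diff by (intro tendsto_intros y)
    show "\<forall>\<^sub>F k in sequentially. (\<Sum>n<N. norm (l1_nth (z - X k) n)) \<le> e"
      using that by eventually_elim (rule order_trans[OF sum_norm_l1_nth_le])
  qed simp
  obtain B where B: "\<And>k. norm (X k) \<le> B"
    using Cauchy_Bseq[OF X] by (auto simp: Bseq_def)
  have "(\<Sum>n<N. norm (y n)) \<le> B" for N
    using y_diff[of 0 B N] B by (simp add: l1_nth_simps)
  then have "summable (\<lambda>n. norm (y n))"
    by (intro summableI_nonneg_bounded) auto
  moreover have "y 0 = 0"
    using y[of 0] by (simp add: LIMSEQ_const_iff)
  ultimately have nth_y: "l1_nth (Abs_l1 y) = y"
    by (simp add: Abs_l1_inverse)
  have "X \<longlonglongrightarrow> Abs_l1 y"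
  proof (rule LIMSEQ_I)
    fix r :: real assume "r > 0"
    then obtain M where M: "norm (X m - X n) < r / 2" if "m \<ge> M" "n \<ge> M" for m n
      using CauchyD[OF X, of "r / 2"] by auto
    have "norm (X m - Abs_l1 y) < r" if "m \<ge> M" for m
    proof -
      have "norm (X m - Abs_l1 y) \<le> r / 2"
      proof (rule norm_l1_leI)
        show "(\<Sum>n<N. norm (l1_nth (X m - Abs_l1 y) n)) \<le> r / 2" for N
          unfolding l1_nth_diff nth_y using M[OF that]
          by (intro y_diff eventually_sequentiallyI[of M]) (simp add: less_imp_le)
      qed
      with \<open>r > 0\<close> show ?thesis by simp
    qed
    then show "\<exists>M. \<forall>m\<ge>M. norm (X m - Abs_l1 y) < r" by blast
  qed
  then show "convergent X" by (rule convergentI)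
qed

section \<open>Operators determined by their values on the unit vectors\<close>

definition l1_extension ::
    "(nat \<Rightarrow> 'a::{real_normed_field,banach} l1) \<Rightarrow> 'a l1 \<Rightarrow> 'a l1" where
  "l1_extension v x = (\<Sum>\<^sub>\<infinity>n\<in>{1..}. l1_nth x n *\<^sub>l v n)"

lemma abs_summable_l1_extension:
  assumes "\<And>n. n \<ge> 1 \<Longrightarrow> norm (v n) \<le> B"
  shows "(\<lambda>n. l1_nth x n *\<^sub>l v n) abs_summable_on {1..}"
proof (rule summable_on_comparison_test)
  show "(\<lambda>n. norm (l1_nth x n) * B) summable_on {1..}"
    by (intro summable_on_cmult_left has_sum_imp_summable[OF norm_l1_has_sum])
qed (unfold norm_l1_scale, auto intro: mult_left_mono[OF assms])

lemma l1_extension_has_sum: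
  assumes "\<And>n. n \<ge> 1 \<Longrightarrow> norm (v n) \<le> B"
  shows "((\<lambda>n. l1_nth x n *\<^sub>l v n) has_sum l1_extension v x) {1..}"
  unfolding l1_extension_def
  by (rule has_sum_infsum[OF abs_summable_summable[OF abs_summable_l1_extension[OF assms]]])

lemma norm_l1_extension_le:
  assumes "\<And>n. n \<ge> 1 \<Longrightarrow> norm (v n) \<le> B"
  shows "norm (l1_extension v x) \<le> norm x * B"
  by (rule norm_infsum_le[OF l1_extension_has_sum[OF assms] has_sum_cmult_left[OF norm_l1_has_sum]])
     (unfold norm_l1_scale, auto intro: mult_left_mono[OF assms])

lemma l1_extension_linear:
  fixes v :: "nat \<Rightarrow> 'a::{real_normed_field,banach} l1"
  assumes "\<And>n. n \<ge> 1 \<Longrightarrow> norm (v n) \<le> B"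
  shows "Vector_Spaces.linear (*\<^sub>l) (*\<^sub>l) (l1_extension v)"
  unfolding Vector_Spaces.linear_iff
proof (intro conjI allI vector_space_l1)
  have has_sum: "((\<lambda>n. l1_nth x n *\<^sub>l v n) has_sum l1_extension v x) {1..}" for x
    using assms by (rule l1_extension_has_sum)
  fix x y :: "'a l1" and c :: 'a
  have "((\<lambda>n. l1_nth (x + y) n *\<^sub>l v n) has_sum (l1_extension v x + l1_extension v y)) {1..}"
    using has_sum_add[OF has_sum[of x] has_sum[of y]]
    by (simp add: l1_nth_simps l1.scale_left_distrib)
  then show "l1_extension v (x + y) = l1_extension v x + l1_extension v y"
    by (rule has_sum_unique[OF has_sum])
  have "((\<lambda>n. l1_nth (c *\<^sub>l x) n *\<^sub>l v n) has_sum (c *\<^sub>l l1_extension v x)) {1..}"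
    using has_sum_bounded_linear[OF bounded_linear_l1_scale_right has_sum[of x], of c]
    by (simp add: l1_nth_simps l1.scale_scale)
  then show "l1_extension v (c *\<^sub>l x) = c *\<^sub>l l1_extension v x"
    by (rule has_sum_unique[OF has_sum])
qed

lemma bounded_linear_l1_linear:
  fixes f :: "'a::{real_normed_field,banach} l1 \<Rightarrow> 'a l1"
  assumes "Vector_Spaces.linear (*\<^sub>l) (*\<^sub>l) f" "\<And>x. norm (f x) \<le> norm x * B"
  shows "bounded_linear f"
proof (rule bounded_linear_intro)
  from assms(1) show "f (x + y) = f x + f y" "f (r *\<^sub>R x) = r *\<^sub>R f x" for x y r
    by (auto simp: Vector_Spaces.linear_iff simp flip: l1_scale_of_real)
qed (rule assms)

text \<open>The series converges absolutely, and its value is identified by applying the coordinate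
  functionals, which are continuous.\<close>

lemma has_sum_l1_units:
  "((\<lambda>n. l1_nth x n *\<^sub>l l1_unit n) has_sum (x::'a::{real_normed_field,banach} l1)) {1..}"
proof -
  have has_sum: "((\<lambda>n. l1_nth x n *\<^sub>l l1_unit n) has_sum (l1_extension l1_unit x)) {1..}"
    by (rule l1_extension_has_sum[where B = 1]) (rule norm_l1_unit_le)
  have "l1_extension l1_unit x = x"
  proof (rule l1_eqI)
    fix m
    have "((\<lambda>n. l1_nth (l1_nth x n *\<^sub>l l1_unit n) m) has_sum l1_nth (l1_extension l1_unit x) m) {1..}"
      by (rule has_sum_bounded_linear[OF bounded_linear_l1_nth has_sum])
    also have "(\<lambda>n. l1_nth (l1_nth x n *\<^sub>l l1_unit n) m) = (\<lambda>n. if n = m then l1_nth x m else 0)"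
      by (auto simp: l1_nth_simps)
    finally have *: "((\<lambda>n. if n = m then l1_nth x m else 0) has_sum l1_nth (l1_extension l1_unit x) m) {1..}" .
    have "((\<lambda>n. if n = m then l1_nth x m else 0) has_sum l1_nth x m) {1..}"
    proof (cases "m = 0")
      case True
      then show ?thesis by (simp cong: if_cong)
    next
      case False
      then have "((\<lambda>n. if n = m then l1_nth x m else 0) has_sum l1_nth x m) {1..} \<longleftrightarrow>
          ((\<lambda>_. l1_nth x m) has_sum l1_nth x m) {m}"
        by (intro has_sum_cong_neutral) auto
      then show ?thesis using has_sum_finite[of "{m}" "\<lambda>_. l1_nth x m"] by simp
    qed
    with * show "l1_nth (l1_extension l1_unit x) m = l1_nth x m"
      by (rule has_sum_unique)
  qed
  with has_sum show ?thesis by simp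
qed

text \<open>Continuity allows \<open>f\<close> to be applied termwise to the expansion of a sequence in unit
  vectors. This is where linearity over the whole scalar field, and not just over the reals, is
  essential: the coefficients are arbitrary scalars.\<close>

lemma linear_eq_l1_extension:
  fixes f :: "'a::{real_normed_field,banach} l1 \<Rightarrow> 'a l1"
  assumes "Vector_Spaces.linear (*\<^sub>l) (*\<^sub>l) f" "\<And>x. norm (f x) \<le> norm x * B"
  shows "f = l1_extension (\<lambda>n. f (l1_unit n))"
proof
  fix x
  have "((\<lambda>n. f (l1_nth x n *\<^sub>l l1_unit n)) has_sum f x) {1..}"
    using bounded_linear_l1_linear[OF assms] has_sum_l1_units
    by (rule has_sum_bounded_linear)
  moreover have "f (c *\<^sub>l x) = c *\<^sub>l f x" for c x
    using assms(1) by (auto simp: Vector_Spaces.linear_iff)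
  ultimately show "f x = l1_extension (\<lambda>n. f (l1_unit n)) x"
    unfolding l1_extension_def by (simp add: infsumI)
qed

text \<open>The distance between the two sides is at most the sum of \<open>norm (l1_nth x n) * norm (v k n - w n)\<close>
  over \<open>n\<close>, whose terms tend to \<open>0\<close> and are dominated by \<open>2 * B\<close> times the summable sequence
  \<open>norm (l1_nth x n)\<close>, so Tannery's theorem applies.\<close>

lemma l1_extension_tendsto:
  fixes v :: "nat \<Rightarrow> nat \<Rightarrow> 'a::{real_normed_field,banach} l1"
  assumes lim: "\<And>n. n \<ge> 1 \<Longrightarrow> (\<lambda>k. v k n) \<longlonglongrightarrow> w n"
    and bound: "\<And>k n. n \<ge> 1 \<Longrightarrow> norm (v k n) \<le> B"
  shows "(\<lambda>k. l1_extension (v k) x) \<longlonglongrightarrow> l1_extension w x"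
proof -
  have bound_w: "norm (w n) \<le> B" if "n \<ge> 1" for n
    by (rule tendsto_upperbound[OF tendsto_norm[OF lim[OF that]]]) (use bound that in auto)
  define d where "d n k = norm (l1_nth x n) * norm (v k n - w n)" for n k
  have d_le: "d n k \<le> norm (l1_nth x n) * (2 * B)" for n k
  proof (cases "n = 0")
    case False
    then have "norm (v k n - w n) \<le> 2 * B"
      using norm_triangle_ineq4[of "v k n" "w n"] bound[of n k] bound_w[of n] by simp
    then show ?thesis by (auto simp: d_def intro: mult_left_mono)
  qed (simp add: d_def)
  have summable_bound: "summable (\<lambda>n. norm (l1_nth x n) * (2 * B))"
    by (intro summable_mult2 summable_norm_l1_nth)
  have summable: "summable (\<lambda>n. d n k)" for k
    by (rule summable_comparison_test'[OF summable_bound, of 0]) (use d_le in \<open>auto simp: d_def\<close>)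
  have le: "norm (l1_extension (v k) x - l1_extension w x) \<le> (\<Sum>n. d n k)" for k
  proof -
    have "((\<lambda>n. l1_nth x n *\<^sub>l v k n) has_sum l1_extension (v k) x) {1..}"
      using bound by (rule l1_extension_has_sum)
    moreover have "((\<lambda>n. - (l1_nth x n *\<^sub>l w n)) has_sum - l1_extension w x) {1..}"
      unfolding has_sum_uminus minus_minus using bound_w by (rule l1_extension_has_sum)
    ultimately have "((\<lambda>n. l1_nth x n *\<^sub>l v k n - l1_nth x n *\<^sub>l w n) has_sum
        (l1_extension (v k) x - l1_extension w x)) {1..}"
      unfolding diff_conv_add_uminus by (rule has_sum_add)
    moreover have "((\<lambda>n. d n k) has_sum (\<Sum>n. d n k)) {1..}"
      using summable by (intro has_sum_atLeast_1) (auto simp: d_def)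
    ultimately show ?thesis
      by (rule norm_infsum_le)
         (simp add: d_def flip: l1.scale_right_diff_distrib)
  qed
  have "(\<lambda>k. d n k) \<longlonglongrightarrow> 0" for n
  proof (cases "n = 0")
    case False
    then have "(\<lambda>k. norm (v k n - w n)) \<longlonglongrightarrow> 0"
      using lim[of n] by (intro tendsto_norm_zero LIM_zero) auto
    then show ?thesis unfolding d_def by (rule tendsto_mult_right_zero)
  qed (simp add: d_def)
  moreover have "norm (d n k) \<le> norm (l1_nth x n) * (2 * B)" for n k
    using d_le[of n k] by (simp add: d_def)
  then have "\<forall>\<^sub>F (n, k) in at_top \<times>\<^sub>F sequentially. norm (d n k) \<le> norm (l1_nth x n) * (2 * B)"
    by (simp add: case_prod_unfold)
  ultimately have "(\<lambda>k. \<Sum>n. d n k) \<longlonglongrightarrow> (\<Sum>n. 0)"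
    by (rule tannerys_theorem[THEN conjunct2, THEN conjunct2, OF _ _ summable_bound]) simp
  then have "(\<lambda>k. \<Sum>n. d n k) \<longlonglongrightarrow> 0" by simp
  then have "(\<lambda>k. l1_extension (v k) x - l1_extension w x) \<longlonglongrightarrow> 0"
    by (rule Lim_null_comparison[rotated]) (simp add: le)
  then show ?thesis by (rule LIM_zero_cancel)
qed

section \<open>Arithmetic means of eventually periodic sequences\<close>

lemma sum_lessThan_add:
  fixes f :: "nat \<Rightarrow> 'b::comm_monoid_add"
  shows "(\<Sum>j<m + n. f j) = (\<Sum>j<m. f j) + (\<Sum>j<n. f (m + j))"
  by (induction n) (simp_all add: add.assoc)

text \<open>The partial sums grow by the sum \<open>p\<close> over one period in every \<open>q\<close> steps. Their deviation from
  the linear function with slope \<open>p / q\<close> is therefore itself eventually periodic, hence takes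
  finitely many values, and is negligible after division by the number of terms.\<close>

lemma Cesaro_mean_eventually_periodic:
  fixes u :: "nat \<Rightarrow> 'b::real_normed_vector"
  assumes q: "q > 0" and periodic: "\<And>j. j \<ge> s \<Longrightarrow> u (j + q) = u j"
  shows "(\<lambda>k. (1 / real k) *\<^sub>R (\<Sum>j<k. u j)) \<longlonglongrightarrow> (1 / real q) *\<^sub>R (\<Sum>j<q. u (s + j))"
proof -
  define p where "p = (\<Sum>j<q. u (s + j))"
  define D where "D k = (\<Sum>j<k. u j) - (real k / real q) *\<^sub>R p" for k
  have period_sum: "(\<Sum>j<q. u (k + j)) = p" if "k \<ge> s" for k
    using that
  proof (induction k rule: dec_induct)
    case (step k)
    have "(\<Sum>j<q. u (Suc k + j)) + u k = (\<Sum>j<Suc q. u (k + j))"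
      by (subst sum.lessThan_Suc_shift) (simp add: add.commute)
    also have "\<dots> = (\<Sum>j<q. u (k + j)) + u k"
      using periodic[of k] step.hyps by simp
    finally show ?case using step.IH by simp
  qed (simp add: p_def)
  have D_periodic: "D (k + q) = D k" if "k \<ge> s" for k
  proof -
    show ?thesis
      using q period_sum[OF that] by (simp add: sum_lessThan_add D_def add_divide_distrib scaleR_left_distrib)
  qed
  have D_range: "D k \<in> D ` {..<s + q}" for k
  proof (induction k rule: less_induct)
    case (less k)
    show ?case
    proof (cases "k < s + q")
      case False
      then have "D k = D (k - q)" using D_periodic[of "k - q"] by simp
      with less[of "k - q"] q False show ?thesis by simp
    qed simp
  qed
  have "finite (D ` {..<s + q})" by simp
  then obtain B where B: "\<And>k. norm (D k) \<le> B"
    using D_range finite_imp_bounded[of "D ` {..<s + q}"] unfolding bounded_iff by metis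
  have "(\<lambda>k. (1 / real k) *\<^sub>R D k) \<longlonglongrightarrow> 0"
  proof (rule Lim_null_comparison)
    show "\<forall>\<^sub>F k in sequentially. norm ((1 / real k) *\<^sub>R D k) \<le> B / real k"
      by (intro always_eventually allI) (simp add: divide_right_mono B)
  qed (rule lim_const_over_n)
  moreover have "\<forall>\<^sub>F k in sequentially.
      (1 / real k) *\<^sub>R D k = (1 / real k) *\<^sub>R (\<Sum>j<k. u j) - (1 / real q) *\<^sub>R p"
    using eventually_gt_at_top[of 0] by eventually_elim (simp add: D_def scaleR_diff_right)
  ultimately have "(\<lambda>k. (1 / real k) *\<^sub>R (\<Sum>j<k. u j) - (1 / real q) *\<^sub>R p) \<longlonglongrightarrow> 0"
    by (rule Lim_transform_eventually)
  then show ?thesis unfolding p_def by (rule LIM_zero_cancel)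
qed


section \<open>The alternating means of the Collatz operator\<close>

lemma l1_extension_l1_unit:
  assumes "n \<noteq> 0"
  shows "l1_extension v (l1_unit n) = v n"
proof -
  have "l1_extension v (l1_unit n) = (\<Sum>\<^sub>\<infinity>m\<in>{n}. v m)"
    unfolding l1_extension_def
    by (rule infsum_cong_neutral)
       (use assms in \<open>auto simp: l1_nth_simps intro!: l1_eqI\<close>)
  then show ?thesis by simp
qed

lemma collatz_op_eq_l1_extension: "collatz_op = l1_extension (\<lambda>n. l1_unit (collatz n))"
  by (simp add: fun_eq_iff collatz_op_def l1_extension_def)

lemma collatz_op_linear: "Vector_Spaces.linear (*\<^sub>l) (*\<^sub>l) collatz_op"
  unfolding collatz_op_eq_l1_extension by (rule l1_extension_linear[OF norm_l1_unit_le])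

lemma norm_collatz_op_le: "norm (collatz_op x) \<le> norm x"
  unfolding collatz_op_eq_l1_extension using norm_l1_extension_le[OF norm_l1_unit_le] by simp

text \<open>The statement includes the index \<open>0\<close>, where both sides vanish since \<open>0\<close> is a fixed point of
  \<open>collatz\<close>; this makes the formula iterable without a side condition.\<close>

lemma collatz_op_l1_unit: "collatz_op (l1_unit n) = l1_unit (collatz n)"
proof (cases "n = 0")
  case True
  have "l1_unit 0 = (0 :: 'a l1)"
    by (rule l1_eqI) (simp add: l1_nth_simps)
  with True norm_collatz_op_le[of "0 :: 'a l1"] show ?thesis
    by (simp add: collatz_def)
qed (simp add: collatz_op_eq_l1_extension l1_extension_l1_unit)

lemma collatz_op_add: "collatz_op (x + y) = collatz_op x + collatz_op y"
  and collatz_op_scale: "collatz_op (c *\<^sub>l x) = c *\<^sub>l collatz_op x"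
  using collatz_op_linear unfolding Vector_Spaces.linear_iff by blast+

lemma collatz_op_funpow_add: "(collatz_op ^^ j) (x + y) = (collatz_op ^^ j) x + (collatz_op ^^ j) y"
  by (induction j) (simp_all add: collatz_op_add)

lemma collatz_op_funpow_scale: "(collatz_op ^^ j) (c *\<^sub>l x) = c *\<^sub>l (collatz_op ^^ j) x"
  by (induction j) (simp_all add: collatz_op_scale)

lemma norm_collatz_op_funpow_le: "norm ((collatz_op ^^ j) x) \<le> norm x"
  by (induction j) (auto intro: order_trans[OF norm_collatz_op_le])

lemma collatz_op_funpow_l1_unit: "(collatz_op ^^ j) (l1_unit n) = l1_unit ((collatz ^^ j) n)"
  by (induction j) (auto simp: collatz_op_l1_unit)

lemma alternating_mean_linear: "Vector_Spaces.linear (*\<^sub>l) (*\<^sub>l) (alternating_mean k)"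
  unfolding Vector_Spaces.linear_iff
  by (intro conjI allI vector_space_l1)
     (simp_all add: alternating_mean_def collatz_op_funpow_add collatz_op_funpow_scale
       scaleR_right_distrib sum.distrib l1_scale_scaleR l1.scale_sum_right)

lemma norm_alternating_mean_le: "norm (alternating_mean k x) \<le> norm x"
proof -
  have "norm (\<Sum>j<k. (-1) ^ j *\<^sub>R (collatz_op ^^ j) x) \<le> (\<Sum>j<k. norm x)"
    by (rule sum_norm_le) (simp add: norm_collatz_op_funpow_le power_abs)
  then show ?thesis
    by (cases "k = 0") (simp_all add: alternating_mean_def field_simps)
qed

lemma alternating_mean_l1_unit:
  "alternating_mean k (l1_unit n) = (1 / real k) *\<^sub>R (\<Sum>j<k. (-1) ^ j *\<^sub>R l1_unit ((collatz ^^ j) n))"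
  by (simp add: alternating_mean_def collatz_op_funpow_l1_unit)

lemma alternating_mean_tendsto_l1_extension:
  fixes x :: "'a::{real_normed_field,banach} l1"
  assumes "\<And>n. n \<ge> 1 \<Longrightarrow> (\<lambda>k. alternating_mean k (l1_unit n)) \<longlonglongrightarrow> w n"
  shows "(\<lambda>k. alternating_mean k x) \<longlonglongrightarrow> l1_extension w x"
proof -
  have "(\<lambda>k. l1_extension (\<lambda>n. alternating_mean k (l1_unit n)) x) \<longlonglongrightarrow> l1_extension w x"
    using assms order_trans[OF norm_alternating_mean_le norm_l1_unit_le]
    by (rule l1_extension_tendsto)
  moreover have "l1_extension (\<lambda>n. alternating_mean k (l1_unit n)) = (alternating_mean k :: 'a l1 \<Rightarrow> 'a l1)" for k
    by (rule linear_eq_l1_extension[where B = 1, symmetric])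
       (simp_all add: alternating_mean_linear norm_alternating_mean_le)
  ultimately show ?thesis by simp
qed

section \<open>Cycles and their basins\<close>

lemma cycle_enumeration_conv_funpow:
  assumes "cycle_enumeration C c k"
  shows "j < k \<Longrightarrow> c (Suc j) = (collatz ^^ j) (c 1)"
    and "(collatz ^^ k) (c 1) = c 1"
proof -
  show nth: "c (Suc j) = (collatz ^^ j) (c 1)" if "j < k" for j
    using that
  proof (induction j)
    case (Suc j)
    have "c (Suc (Suc j)) = collatz (c (Suc j))"
      using assms Suc.prems by (simp add: cycle_enumeration_def)
    with Suc show ?case by simp
  qed simp
  from assms have "k \<ge> 1" "collatz (c k) = c 1"
    by (auto simp: cycle_enumeration_def)
  with nth[of "k - 1"] show "(collatz ^^ k) (c 1) = c 1"
    by (cases k) auto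
qed

text \<open>Forgetting the starting point, a cycle is an orbit that contains its own base point, so the
  theory of cyclic orbits applies to it.\<close>

lemma cycle_enumeration_imp_cyclic_on:
  assumes "cycle_enumeration C c k"
  shows "cyclic_on collatz C" "c 1 \<in> C"
proof -
  from assms have k: "k \<ge> 1" and C: "C = c ` {1..k}"
    by (auto simp: cycle_enumeration_def bij_betw_def)
  then show "c 1 \<in> C" by auto
  have "C = (\<lambda>j. c (Suc j)) ` {..<k}"
    unfolding C image_comp[symmetric, of c Suc, unfolded o_def] image_Suc_lessThan ..
  also have "\<dots> = (\<lambda>j. (collatz ^^ j) (c 1)) ` {..<k}"
    by (intro image_cong refl cycle_enumeration_conv_funpow(1)[OF assms]) simp
  also have "\<dots> = {(collatz ^^ j) (c 1) |j. j < k}"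
    by auto
  also have "\<dots> = orbit collatz (c 1)"
    using cycle_enumeration_conv_funpow(2)[OF assms] k by (intro orbit_altdef_bounded[symmetric]) auto
  finally show "cyclic_on collatz C"
    using \<open>c 1 \<in> C\<close> by (auto simp: cyclic_on_def)
qed

text \<open>The iterates below the minimal period, the first return time of \<open>m\<close>, are distinct and
  exhaust the orbit.\<close>

lemma periodic_imp_is_cycle_orbit:
  assumes "m \<in> orbit collatz m" "orbit collatz m \<subseteq> {1..}"
  shows "is_cycle (orbit collatz m)"
proof -
  define k where "k = funpow_dist1 collatz m m"
  have "inj_on (\<lambda>j. (collatz ^^ (j - 1)) m) {1..k}"
  proof (rule inj_onI)
    fix i j
    assume ij: "i \<in> {1..k}" "j \<in> {1..k}" "(collatz ^^ (i - 1)) m = (collatz ^^ (j - 1)) m"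
    then have "i - 1 = j - 1"
      using inj_onD[OF inj_on_funpow_dist1[OF assms(1)], of "i - 1" "j - 1"] by (auto simp: k_def)
    with ij show "i = j" by auto
  qed
  moreover have "(\<lambda>j. (collatz ^^ (j - 1)) m) ` {1..k} = orbit collatz m"
  proof -
    have Suc: "{1..k} = Suc ` {0..<k}" by (simp add: atLeastLessThanSuc_atLeastAtMost)
    show ?thesis
      unfolding orbit_conv_funpow_dist1[OF assms(1)] k_def[symmetric] Suc image_image by simp
  qed
  moreover have "(collatz ^^ k) m = m"
    unfolding k_def by (rule funpow_dist1_prop[OF assms(1)])
  moreover have "collatz ((collatz ^^ (j - 1)) m) = (collatz ^^ j) m" if "j \<ge> 1" for j
    using that by (cases j) auto
  moreover have "k \<ge> 1" by (simp add: k_def)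
  ultimately have "cycle_enumeration (orbit collatz m) (\<lambda>j. (collatz ^^ (j - 1)) m) k"
    by (auto simp: cycle_enumeration_def bij_betw_def)
  with assms(2) show ?thesis by (auto simp: is_cycle_def)
qed

lemma collatz_pos: "n \<ge> 1 \<Longrightarrow> collatz n \<ge> 1"
  unfolding collatz_def by presburger

lemma collatz_funpow_pos: "n \<ge> 1 \<Longrightarrow> (collatz ^^ k) n \<ge> 1"
  by (induction k) (use collatz_pos in auto)

text \<open>A trajectory that does not tend to infinity stays below some \<open>Z\<close> infinitely often, so it takes
  some value twice by the pigeonhole principle; the second visit makes that value periodic.\<close>

lemma not_divergent_imp_basin:
  assumes "n \<ge> 1" "\<not> divergent_trajectory n"
  shows "\<exists>C. is_cycle C \<and> n \<in> basin C"
proof -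
  obtain Z where Z: "\<exists>\<^sub>F k in sequentially. (collatz ^^ k) n < Z"
    using assms(2) by (auto simp: divergent_trajectory_def filterlim_at_top not_eventually not_le)
  define K where "K = {k. (collatz ^^ k) n < Z}"
  have "infinite K"
    using Z by (simp add: K_def frequently_cofinite flip: cofinite_eq_sequentially)
  moreover have "finite ((\<lambda>k. (collatz ^^ k) n) ` K)"
    by (rule finite_subset[of _ "{..<Z}"]) (auto simp: K_def)
  ultimately have "\<not> inj_on (\<lambda>k. (collatz ^^ k) n) K"
    using finite_imageD by blast
  then obtain a b where ab: "a < b" "(collatz ^^ a) n = (collatz ^^ b) n"
    unfolding inj_on_def by (metis linorder_neqE_nat)
  define m where "m = (collatz ^^ a) n"
  have "(collatz ^^ (b - a)) m = (collatz ^^ (b - a + a)) n"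
    by (simp only: m_def funpow_add o_apply)
  with ab have "(collatz ^^ (b - a)) m = m"
    by (simp add: m_def)
  with ab have self: "m \<in> orbit collatz m"
    by (auto simp: orbit_altdef intro!: exI[of _ "b - a"])
  moreover have "orbit collatz m \<subseteq> {1..}"
    using collatz_funpow_pos[OF collatz_funpow_pos[OF assms(1)]]
    by (auto simp: orbit_altdef m_def)
  ultimately have "is_cycle (orbit collatz m)" by (rule periodic_imp_is_cycle_orbit)
  moreover have "n \<in> basin (orbit collatz m)"
    using assms(1) self by (auto simp: basin_def m_def)
  ultimately show ?thesis by blast
qed

text \<open>A cycle is never left again, so a late enough iterate lies on both cycles, and each of them is
  the orbit of that iterate.\<close>

lemma basin_disjoint:
  assumes "cyclic_on collatz C" "cyclic_on collatz D" "n \<in> basin C" "n \<in> basin D"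
  shows "C = D"
proof -
  from assms obtain a b where "(collatz ^^ a) n \<in> C" "(collatz ^^ b) n \<in> D"
    by (auto simp: basin_def)
  then have "(collatz ^^ (b + a)) n \<in> C" "(collatz ^^ (a + b)) n \<in> D"
    using assms(1,2) by (auto simp only: funpow_add o_apply intro: cyclic_on_funpow_in)
  then show ?thesis
    using assms(1,2) by (metis add.commute orbit_cyclic_eq3)
qed

lemma funpow_hitting_time:
  assumes "cyclic_on collatz C" "m \<in> C" "n \<in> basin C"
  shows "(collatz ^^ hitting_time m n) n = m"
proof -
  from assms(3) obtain a where a: "(collatz ^^ a) n \<in> C" by (auto simp: basin_def)
  with assms(1,2) have "m \<in> orbit collatz ((collatz ^^ a) n)"
    by (simp add: orbit_cyclic_eq3)
  then obtain b where "(collatz ^^ b) ((collatz ^^ a) n) = m"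
    by (auto simp: orbit_altdef)
  then have "(collatz ^^ (b + a)) n = m" by (simp add: funpow_add)
  then show ?thesis unfolding hitting_time_def by (rule LeastI)
qed

section \<open>Limits of the alternating means on unit vectors\<close>

lemma alternating_mean_l1_unit_tendsto:
  fixes c :: "nat \<Rightarrow> nat"
  assumes enum: "cycle_enumeration C c k" and n: "n \<in> basin C"
  shows "(\<lambda>m. alternating_mean m (l1_unit n :: 'a::{real_normed_field,banach} l1)) \<longlonglongrightarrow>
    (if even k then ((-1) ^ hitting_time (c 1) n / of_nat k) *\<^sub>l
       (\<Sum>j = 1..k. (-1) ^ (j - 1) *\<^sub>l l1_unit (c j)) else 0)"
proof -
  define s where "s = hitting_time (c 1) n"
  define u :: "nat \<Rightarrow> 'a l1" where "u j = (-1) ^ j *\<^sub>R l1_unit ((collatz ^^ j) n)" for j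
  have k: "k > 0" using enum by (auto simp: cycle_enumeration_def)
  have s: "(collatz ^^ s) n = c 1"
    unfolding s_def using cycle_enumeration_imp_cyclic_on[OF enum] n by (rule funpow_hitting_time)
  have after_s: "(collatz ^^ (s + j)) n = (collatz ^^ j) (c 1)" for j
    using s by (simp add: funpow_add add.commute[of s])
  have return: "(collatz ^^ (j + k)) n = (collatz ^^ j) n" if "j \<ge> s" for j
  proof -
    have "(collatz ^^ (s + (j - s + k))) n = (collatz ^^ (s + (j - s))) n"
      unfolding after_s by (simp add: funpow_add cycle_enumeration_conv_funpow(2)[OF enum, simplified])
    with that show ?thesis by simp
  qed
  have shift: "u (j + k) = (-1) ^ k *\<^sub>R u j" if "j \<ge> s" for j
    using return[OF that] by (simp add: u_def power_add mult.commute)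
  have mean: "alternating_mean m (l1_unit n) = (1 / real m) *\<^sub>R (\<Sum>j<m. u j)" for m
    by (simp add: alternating_mean_l1_unit u_def)
  show ?thesis
  proof (cases "even k")
    case True
    have "(\<Sum>j<k. u (s + j)) = (-1) ^ s *\<^sub>R (\<Sum>j<k. (-1) ^ j *\<^sub>R l1_unit (c (Suc j)))"
      unfolding scaleR_sum_right
    proof (rule sum.cong)
      fix j assume "j \<in> {..<k}"
      then have "(collatz ^^ (s + j)) n = c (Suc j)"
        unfolding after_s by (intro cycle_enumeration_conv_funpow(1)[OF enum, symmetric]) simp
      then show "u (s + j) = (-1) ^ s *\<^sub>R (-1) ^ j *\<^sub>R l1_unit (c (Suc j))"
        by (simp add: u_def power_add)
    qed simp
    also have "(\<Sum>j<k. (-1) ^ j *\<^sub>R l1_unit (c (Suc j)) :: 'a l1)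
        = (\<Sum>j = 1..k. (-1) ^ (j - 1) *\<^sub>l l1_unit (c j))"
      by (simp add: l1_scale_neg_one_power sum.atLeast1_atMost_eq)
    finally have "(1 / real k) *\<^sub>R (\<Sum>j<k. u (s + j))
        = (1 / real k * (-1) ^ s) *\<^sub>R (\<Sum>j = 1..k. (-1) ^ (j - 1) *\<^sub>l l1_unit (c j))"
      by simp
    also have "\<dots> = ((-1) ^ s / of_nat k) *\<^sub>l (\<Sum>j = 1..k. (-1) ^ (j - 1) *\<^sub>l l1_unit (c j))"
      unfolding l1_scale_of_real[symmetric] by simp
    finally show ?thesis
      using Cesaro_mean_eventually_periodic[of k s u] k shift True by (simp add: mean s_def)
  next
    case False
    \<comment> \<open>The sign flips on each passage through an odd cycle, so \<open>u\<close> has period \<open>2 * k\<close> only.\<close>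
    have "u (s + (k + j)) = - u (s + j)" for j
      using shift[of "s + j"] False by (simp add: add.commute add.left_commute)
    then have "(\<Sum>j<k + k. u (s + j)) = 0"
      by (simp add: sum_lessThan_add sum_negf)
    moreover have "u (j + (k + k)) = u j" if "j \<ge> s" for j
      using shift[OF that] shift[of "j + k"] that False by (simp flip: add.assoc)
    ultimately show ?thesis
      using Cesaro_mean_eventually_periodic[of "k + k" s u] k False by (simp add: mean)
  qed
qed

text \<open>The vector \<open>y\<close> is an eigenvector for the eigenvalue \<open>-1\<close>: the Collatz map swaps 1 and 2. It
  shows that the norm of the limit operator is at least 1.\<close>

lemma limit_op_fixes_trivial_cycle:
  defines "y \<equiv> l1_unit 1 - l1_unit 2 :: 'a::{real_normed_field,banach} l1"
  shows "limit_op y = y" "y \<noteq> 0"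
proof -
  have collatz: "collatz 1 = 2" "collatz 2 = 1" by (simp_all add: collatz_def)
  have y: "y = l1_unit 1 + (-1) *\<^sub>l l1_unit 2"
    by (simp add: y_def)
  have "collatz_op y = - y"
    unfolding y collatz_op_add collatz_op_scale collatz_op_l1_unit collatz by simp
  then have "(collatz_op ^^ j) y = (-1) ^ j *\<^sub>l y" for j
    by (induction j) (simp_all add: collatz_op_scale)
  then have "(-1) ^ j *\<^sub>R (collatz_op ^^ j) y = y" for j
    by (simp add: l1_scale_neg_one_power flip: power_mult_distrib)
  then have "alternating_mean k y = y" if "k > 0" for k
    using that by (simp add: alternating_mean_def sum_constant_scaleR)
  then have "(\<lambda>k. alternating_mean k y) \<longlonglongrightarrow> y"
    by (intro tendsto_eventually eventually_sequentiallyI[of 1]) auto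
  then show "limit_op y = y" unfolding limit_op_def by (rule limI)
  have "l1_nth y 1 = 1" by (simp add: y_def l1_nth_diff l1_nth_simps)
  then show "y \<noteq> 0" by (auto simp: l1_nth_simps)
qed

section \<open>The limit operator\<close>

theorem theorem6p5:
  fixes I :: "nat set"
    and C :: "nat \<Rightarrow> nat set"
    and c :: "nat \<Rightarrow> nat \<Rightarrow> nat"
  assumes no_divergent: "\<not> (\<exists>n\<ge>1. divergent_trajectory n)"
    and cycles: "bij_betw C I {A. is_cycle A}"
    and enum: "\<And>i. i \<in> I \<Longrightarrow> cycle_enumeration (C i) (c i) (card (C i))"
  shows "(\<forall>x :: 'a::{real_normed_field,banach} l1. convergent (\<lambda>k. alternating_mean k x))
    \<and> Vector_Spaces.linear (*\<^sub>l) (*\<^sub>l) (limit_op :: 'a l1 \<Rightarrow> 'a l1)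
    \<and> bounded_linear (limit_op :: 'a l1 \<Rightarrow> 'a l1)
    \<and> onorm (limit_op :: 'a l1 \<Rightarrow> 'a l1) = 1
    \<and> (\<forall>x :: 'a l1.
         (\<forall>i\<in>I. (\<lambda>n. (-1) ^ hitting_time (c i 1) n * l1_nth x n) summable_on basin (C i)) \<and>
         ((\<lambda>i. ((\<Sum>\<^sub>\<infinity>n\<in>basin (C i). (-1) ^ hitting_time (c i 1) n * l1_nth x n)
                  / of_nat (card (C i)))
               *\<^sub>l (\<Sum>j = 1..card (C i). (-1) ^ (j - 1) *\<^sub>l l1_unit (c i j)))
           has_sum limit_op x) {i \<in> I. even (card (C i))})"
proof -
  define W :: "nat \<Rightarrow> 'a l1" where
    "W i = (\<Sum>j = 1..card (C i). (-1) ^ (j - 1) *\<^sub>l l1_unit (c i j))" for i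
  define v :: "nat \<Rightarrow> 'a l1" where "v n = limit_op (l1_unit n)" for n
  have cyclic: "cyclic_on collatz (C i)" if "i \<in> I" for i
    using enum[OF that] by (rule cycle_enumeration_imp_cyclic_on)
  have cover: "\<exists>i\<in>I. n \<in> basin (C i)" if n: "n \<ge> 1" for n
  proof -
    obtain A where "is_cycle A" "n \<in> basin A"
      using not_divergent_imp_basin[OF n] n no_divergent by blast
    moreover from this cycles have "A \<in> C ` I" by (simp add: bij_betw_def)
    ultimately show ?thesis by blast
  qed
  have unique: "i = j" if "i \<in> I" "j \<in> I" "n \<in> basin (C i)" "n \<in> basin (C j)" for i j n
  proof -
    have "C i = C j"
      using cyclic[OF that(1)] cyclic[OF that(2)] that(3,4) by (rule basin_disjoint)
    with that cycles show ?thesis by (auto simp: bij_betw_def dest: inj_onD)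
  qed
  \<comment> \<open>Pairing each positive integer with its cycle turns the sum over all unit vectors into a
    double sum over cycles and their basins.\<close>
  have partition: "bij_betw snd (SIGMA i:I. basin (C i)) {1..}"
    unfolding bij_betw_def
  proof
    show "inj_on snd (SIGMA i:I. basin (C i))"
      by (auto intro!: inj_onI dest: unique)
    show "snd ` (SIGMA i:I. basin (C i)) = {1..}"
      using cover by (force simp: basin_def)
  qed

  have lim_unit: "(\<lambda>k. alternating_mean k (l1_unit n)) \<longlonglongrightarrow> v n"
    and v_eq: "v n = (if even (card (C i))
      then ((-1) ^ hitting_time (c i 1) n / of_nat (card (C i))) *\<^sub>l W i else 0)"
    if "i \<in> I" "n \<in> basin (C i)" for i n
  proof -
    note lim = alternating_mean_l1_unit_tendsto[OF enum[OF that(1)] that(2), where 'a = 'a,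
        folded W_def]
    then show v: "v n = (if even (card (C i))
        then ((-1) ^ hitting_time (c i 1) n / of_nat (card (C i))) *\<^sub>l W i else 0)"
      unfolding v_def limit_op_def by (rule limI)
    show "(\<lambda>k. alternating_mean k (l1_unit n)) \<longlonglongrightarrow> v n"
      unfolding v by (rule lim)
  qed
  have norm_v: "norm (v n) \<le> 1" if "n \<ge> 1" for n
  proof -
    obtain i where "i \<in> I" "n \<in> basin (C i)" using cover \<open>n \<ge> 1\<close> by blast
    then have "(\<lambda>k. norm (alternating_mean k (l1_unit n :: 'a l1))) \<longlonglongrightarrow> norm (v n)"
      by (intro tendsto_norm lim_unit)
    then show ?thesis
      by (rule tendsto_upperbound)
         (simp_all add: order_trans[OF norm_alternating_mean_le norm_l1_unit_le])
  qed

  have lim: "(\<lambda>k. alternating_mean k x) \<longlonglongrightarrow> l1_extension v x" for x :: "'a l1"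
    using cover lim_unit by (intro alternating_mean_tendsto_l1_extension) blast
  then have limit_op_eq: "limit_op = l1_extension v"
    by (simp add: fun_eq_iff limit_op_def limI)
  have linear: "Vector_Spaces.linear (*\<^sub>l) (*\<^sub>l) (limit_op :: 'a l1 \<Rightarrow> 'a l1)"
    unfolding limit_op_eq using norm_v by (rule l1_extension_linear)
  have norm_le: "norm (limit_op x) \<le> norm x * 1" for x :: "'a l1"
    unfolding limit_op_eq using norm_v by (rule norm_l1_extension_le)
  have bounded: "bounded_linear (limit_op :: 'a l1 \<Rightarrow> 'a l1)"
    using linear norm_le by (rule bounded_linear_l1_linear)
  have "onorm (limit_op :: 'a l1 \<Rightarrow> 'a l1) \<le> 1"
    using norm_le by (intro onorm_bound) (auto simp: mult.commute)
  moreover have "1 \<le> onorm (limit_op :: 'a l1 \<Rightarrow> 'a l1)"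
    using onorm[OF bounded, of "l1_unit 1 - l1_unit 2"]
      limit_op_fixes_trivial_cycle[where 'a = 'a] by simp
  ultimately have onorm: "onorm (limit_op :: 'a l1 \<Rightarrow> 'a l1) = 1" by simp

  have summable: "(\<lambda>n. (-1) ^ hitting_time (c i 1) n * l1_nth x n) summable_on basin (C i)"
    for i and x :: "'a l1"
  proof (rule abs_summable_summable)
    have "(\<lambda>n. norm (l1_nth x n)) summable_on basin (C i)"
      by (rule summable_on_subset_banach[OF has_sum_imp_summable[OF norm_l1_has_sum]])
         (auto simp: basin_def)
    then show "(\<lambda>n. (-1) ^ hitting_time (c i 1) n * l1_nth x n) abs_summable_on basin (C i)"
      by (simp add: norm_mult norm_power)
  qed
  have formula: "((\<lambda>i. ((\<Sum>\<^sub>\<infinity>n\<in>basin (C i). (-1) ^ hitting_time (c i 1) n * l1_nth x n)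
      / of_nat (card (C i))) *\<^sub>l W i) has_sum limit_op x) {i \<in> I. even (card (C i))}"
    for x :: "'a l1"
  proof -
    define S where "S i = (\<Sum>\<^sub>\<infinity>n\<in>basin (C i). (-1) ^ hitting_time (c i 1) n * l1_nth x n)" for i
    have "((\<lambda>n. l1_nth x n *\<^sub>l v n) has_sum limit_op x) {1..}"
      unfolding limit_op_eq using norm_v by (rule l1_extension_has_sum)
    then have "((\<lambda>(i, n). l1_nth x n *\<^sub>l v n) has_sum limit_op x) (SIGMA i:I. basin (C i))"
      by (subst (asm) has_sum_reindex_bij_betw[OF partition, symmetric]) (simp add: case_prod_unfold)
    moreover have "((\<lambda>n. case (i, n) of (i, n) \<Rightarrow> l1_nth x n *\<^sub>l v n) has_sum
        (if even (card (C i)) then (S i / of_nat (card (C i))) *\<^sub>l W i else 0)) (basin (C i))"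
      if "i \<in> I" for i
    proof (cases "even (card (C i))")
      case True
      have "bounded_linear (\<lambda>a. (a / of_nat (card (C i))) *\<^sub>l W i)"
        by (rule bounded_linear_compose[OF bounded_linear_l1_scale_left bounded_linear_divide])
      then have "((\<lambda>n. ((-1) ^ hitting_time (c i 1) n * l1_nth x n / of_nat (card (C i))) *\<^sub>l W i)
          has_sum (S i / of_nat (card (C i))) *\<^sub>l W i) (basin (C i))"
        unfolding S_def by (rule has_sum_bounded_linear[OF _ has_sum_infsum[OF summable]])
      also have "?this \<longleftrightarrow> ((\<lambda>n. l1_nth x n *\<^sub>l v n)
          has_sum (S i / of_nat (card (C i))) *\<^sub>l W i) (basin (C i))"
        by (intro has_sum_cong) (simp add: v_eq[OF that] True l1.scale_scale mult.commute)
      finally show ?thesis using True by simp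
    next
      case False
      then have "l1_nth x n *\<^sub>l v n = 0" if "n \<in> basin (C i)" for n
        using v_eq[OF \<open>i \<in> I\<close> that]
        by (simp add: l1.scale_zero_right)
      with False show ?thesis by (simp add: has_sum_0)
    qed
    ultimately have "((\<lambda>i. if even (card (C i)) then (S i / of_nat (card (C i))) *\<^sub>l W i else 0)
        has_sum limit_op x) I"
      by (rule has_sum_SigmaD)
    also have "?this \<longleftrightarrow> ((\<lambda>i. (S i / of_nat (card (C i))) *\<^sub>l W i) has_sum limit_op x)
        {i \<in> I. even (card (C i))}"
      by (rule has_sum_cong_neutral) auto
    finally show ?thesis unfolding S_def .
  qed
  show ?thesis
    using convergentI[OF lim] linear bounded onorm summable formula unfolding W_def by blast
qed

end
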